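(* Let $\mathcal G$ be a connected groupoid and let $A$ be a ring. For all objects $x,z\in\mathcal G_0$, every transversal $\tau(x)$ for $x$ and every transversal $\lambda(z)$ for $z$, the categories $\mathcal D_{\tau(x)}(A)$ and $\mathcal D_{\lambda(z)}(A)$ are isomorphic.
   Context: Conventions. Rings are associative, not necessarily unital; ideals are two-sided. A groupoid $\mathcal G$ is a small category in which every morphism is invertible; it is identified with its set of morphisms, and its set of objects $\mathcal G_0$ is identified with the set of identity morphisms. For $g\in\mathcal G$, $s(g)=g^{-1}g$ and $t(g)=gg^{-1}$ are its source and target; $gh$ is defined iff $s(g)=t(h)$. Put $\mathcal G(y,z)=\{g: s(g)=y,\ t(g)=z\}$ and $\mathcal G(x)=\mathcal G(x,x)$ (a group). $\mathcal G$ is connected if $\mathcal G(y,z)\neq\emptyset$ for all $y,z\in\mathcal G_0$. A transversal for $x\in\mathcal G_0$ is a family $\tau(x)=\{\tau_y: y\in\mathcal G_0\}$ with $\tau_y\in\mathcal G(x,y)$ for each $y$ and $\tau_x=x$. Given $\tau(x)$, put $g_x=\tau_{t(g)}^{-1}g\tau_{s(g)}\in\mathcal G(x)$ for $g\in\mathcal G$. A partial action of a group $H$ (identity $e$) on a ring $R$ is a family $(R_h,\gamma_h)_{h\in H}$ where $R_h$ is an ideal of $R$, $\gamma_h:R_{h^{-1}}\to R_h$ is a ring isomorphism, $R_e=R$, $\gamma_e=\mathrm{id}_R$, and $\gamma_{hk}$ extends $\gamma_h\circ\gamma_k$ (the latter being defined on $\gamma_k^{-1}(R_{h^{-1}}\cap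 R_k)$) for all $h,k\in H$. The category $\mathcal D_{\tau(x)}(A)$. Objects are data $(I,\gamma_{\tau(x)},\gamma_{(x)})$ consisting of: (a) a family $I=\{I_y\}_{y\in\mathcal G_0}$ of ideals of $A$; (b) a family of ring isomorphisms $\gamma_{\tau(x)}=\{\gamma_{\tau_y}:I_{\tau_y^{-1}}\to I_{\tau_y}\}_{y\in\mathcal G_0}$; (c) a partial action $\gamma_{(x)}=(I_h,\gamma_h)_{h\in\mathcal G(x)}$ of the group $\mathcal G(x)$ on $I_x$; such that (d) $\gamma_x=\gamma_{\tau_x}$ is the identity map of $I_x=I_{\tau_x}$; (e) $I_{\tau_y}$ is an ideal of $I_y$ and $I_{\tau_y^{-1}}$ is an ideal of $I_x$, for all $y\in\mathcal G_0$; (f) $\gamma_{\tau_{t(g)}}\big(I_{\tau_{t(g)}^{-1}}\cap\gamma_{g_x}(I_{\tau_{s(g)}^{-1}}\cap I_{g_x^{-1}})\big)$ is an ideal of $I_{t(g)}$, for all $g\in\mathcal G$. A morphism $(I,\gamma_{\tau(x)},\gamma_{(x)})\to(I',\gamma'_{\tau(x)},\gamma'_{(x)})$ is a family of ring homomorphisms $f=\{f_y:I_y\to I'_y\}_{y\in\mathcal G_0}$ such that, for all $y\in\mathcal G_0$, $f_y(I_{\tau_y})\subseteq I'_{\tau_y}$ (if $y\ne x$), $f_x(I_{\tau_y^{-1}})\subseteq I'_{\tau_y^{-1}}$ and $\gamma'_{\tau_y}f_x=f_y\gamma_{\tau_y}$ on $I_{\tau_y^{-1}}$; and, for all $h\in\mathcal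 G(x)$, $f_x(I_h)\subseteq I'_h$ and $\gamma'_hf_x=f_x\gamma_h$ on $I_{h^{-1}}$. Composition is componentwise. Two categories are isomorphic if there are mutually inverse functors between them. *)

theory Defs
  imports "HOL-Algebra.Group"
begin

section \<open>Groupoids\<close>

text \<open>A groupoid is identified with its set of morphisms, and its objects with the identity
  morphisms; so \<open>src\<close> and \<open>tgt\<close> take values in the carrier. The composite \<open>g \<cdot> h\<close> is meaningful
  only when \<open>src g = tgt h\<close>.\<close>

record 'g groupoid = "'g partial_object" +
  src :: "'g \<Rightarrow> 'g" ("src\<index>")
  tgt :: "'g \<Rightarrow> 'g" ("tgt\<index>")
  comp :: "'g \<Rightarrow> 'g \<Rightarrow> 'g" (infixl "\<cdot>\<index>" 70)

locale groupoid =
  fixes G (structure)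
  assumes src_closed: "g \<in> carrier G \<Longrightarrow> src g \<in> carrier G"
    and tgt_closed: "g \<in> carrier G \<Longrightarrow> tgt g \<in> carrier G"
    and src_src: "g \<in> carrier G \<Longrightarrow> src (src g) = src g"
    and tgt_src: "g \<in> carrier G \<Longrightarrow> tgt (src g) = src g"
    and src_tgt: "g \<in> carrier G \<Longrightarrow> src (tgt g) = tgt g"
    and tgt_tgt: "g \<in> carrier G \<Longrightarrow> tgt (tgt g) = tgt g"
    and comp_closed: "\<lbrakk>g \<in> carrier G; h \<in> carrier G; src g = tgt h\<rbrakk> \<Longrightarrow> g \<cdot> h \<in> carrier G"
    and src_comp: "\<lbrakk>g \<in> carrier G; h \<in> carrier G; src g = tgt h\<rbrakk> \<Longrightarrow> src (g \<cdot> h) = src h"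
    and tgt_comp: "\<lbrakk>g \<in> carrier G; h \<in> carrier G; src g = tgt h\<rbrakk> \<Longrightarrow> tgt (g \<cdot> h) = tgt g"
    and comp_assoc: "\<lbrakk>g \<in> carrier G; h \<in> carrier G; k \<in> carrier G; src g = tgt h; src h = tgt k\<rbrakk>
          \<Longrightarrow> (g \<cdot> h) \<cdot> k = g \<cdot> (h \<cdot> k)"
    and comp_src: "g \<in> carrier G \<Longrightarrow> g \<cdot> src g = g"
    and tgt_comp_left: "g \<in> carrier G \<Longrightarrow> tgt g \<cdot> g = g"
    and invertible: "g \<in> carrier G \<Longrightarrow>
          \<exists>h\<in>carrier G. src h = tgt g \<and> tgt h = src g \<and> h \<cdot> g = src g \<and> g \<cdot> h = tgt g"

definition gobjects :: "('g, 'b) groupoid_scheme \<Rightarrow> 'g set"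
  where "gobjects G = {e \<in> carrier G. src\<^bsub>G\<^esub> e = e}"

definition ghom :: "('g, 'b) groupoid_scheme \<Rightarrow> 'g \<Rightarrow> 'g \<Rightarrow> 'g set"
  where "ghom G y z = {g \<in> carrier G. src\<^bsub>G\<^esub> g = y \<and> tgt\<^bsub>G\<^esub> g = z}"

definition ginv :: "('g, 'b) groupoid_scheme \<Rightarrow> 'g \<Rightarrow> 'g"
  where "ginv G g = (THE h. h \<in> ghom G (tgt\<^bsub>G\<^esub> g) (src\<^bsub>G\<^esub> g)
            \<and> h \<cdot>\<^bsub>G\<^esub> g = src\<^bsub>G\<^esub> g \<and> g \<cdot>\<^bsub>G\<^esub> h = tgt\<^bsub>G\<^esub> g)"

definition isotropy :: "('g, 'b) groupoid_scheme \<Rightarrow> 'g \<Rightarrow> 'g monoid"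
  where "isotropy G x = \<lparr>carrier = ghom G x x, mult = comp G, one = x\<rparr>"

definition connected_groupoid :: "('g, 'b) groupoid_scheme \<Rightarrow> bool"
  where "connected_groupoid G \<longleftrightarrow>
    groupoid G \<and> (\<forall>y\<in>gobjects G. \<forall>z\<in>gobjects G. ghom G y z \<noteq> {})"

definition transversal :: "('g, 'b) groupoid_scheme \<Rightarrow> 'g \<Rightarrow> ('g \<Rightarrow> 'g) \<Rightarrow> bool"
  where "transversal G x \<tau> \<longleftrightarrow> (\<forall>y\<in>gobjects G. \<tau> y \<in> ghom G x y) \<and> \<tau> x = x"

text \<open>The element \<open>g\<^sub>x\<close> of the isotropy group at \<open>x\<close>, for a transversal \<open>\<tau>\<close> for \<open>x\<close>.\<close>

definition to_isotropy :: "('g, 'b) groupoid_scheme \<Rightarrow> ('g \<Rightarrow> 'g) \<Rightarrow> 'g \<Rightarrow> 'g"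
  where "to_isotropy G \<tau> g = ginv G (\<tau> (tgt\<^bsub>G\<^esub> g)) \<cdot>\<^bsub>G\<^esub> g \<cdot>\<^bsub>G\<^esub> \<tau> (src\<^bsub>G\<^esub> g)"

context groupoid
begin

lemma ginv_props:
  assumes g: "g \<in> carrier G"
  shows "ginv G g \<in> ghom G (tgt g) (src g)" "ginv G g \<cdot> g = src g" "g \<cdot> ginv G g = tgt g"
proof -
  let ?P = "\<lambda>h. h \<in> ghom G (tgt g) (src g) \<and> h \<cdot> g = src g \<and> g \<cdot> h = tgt g"
  have "\<exists>!h. ?P h"
  proof (rule ex_ex1I)
    show "\<exists>h. ?P h"
      using invertible[OF g] by (auto simp: ghom_def)
  next
    fix h k assume h: "?P h" and k: "?P k"
    have "h = h \<cdot> (g \<cdot> k)"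
      using h k comp_src[of h] by (auto simp: ghom_def)
    also have "\<dots> = (h \<cdot> g) \<cdot> k"
      using comp_assoc[of h g k] g h k by (auto simp: ghom_def)
    also have "\<dots> = k"
      using h k tgt_comp_left[of k] by (auto simp: ghom_def)
    finally show "h = k" .
  qed
  then have "?P (ginv G g)"
    unfolding ginv_def by (rule theI')
  then show "ginv G g \<in> ghom G (tgt g) (src g)" "ginv G g \<cdot> g = src g" "g \<cdot> ginv G g = tgt g"
    by auto
qed

lemma gobjects_iff: "x \<in> gobjects G \<longleftrightarrow> x \<in> carrier G \<and> src x = x \<and> tgt x = x"
  using tgt_src by (force simp: gobjects_def)

lemma isotropy_group:
  assumes x: "x \<in> gobjects G"
  shows "group (isotropy G x)"
proof (rule groupI)
  fix g assume "g \<in> carrier (isotropy G x)"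
  then have g: "g \<in> carrier G" "src g = x" "tgt g = x"
    by (auto simp: isotropy_def ghom_def)
  show "\<exists>h\<in>carrier (isotropy G x). h \<otimes>\<^bsub>isotropy G x\<^esub> g = \<one>\<^bsub>isotropy G x\<^esub>"
    using ginv_props[OF g(1)] g by (intro bexI[of _ "ginv G g"]) (auto simp: isotropy_def)
  show "\<one>\<^bsub>isotropy G x\<^esub> \<otimes>\<^bsub>isotropy G x\<^esub> g = g"
    using g tgt_comp_left[of g] by (simp add: isotropy_def)
qed (use x gobjects_iff comp_closed src_comp tgt_comp comp_assoc in
      \<open>auto simp: isotropy_def ghom_def\<close>)

lemma isotropy_inv:
  assumes x: "x \<in> gobjects G" and g: "g \<in> ghom G x x"
  shows "inv\<^bsub>isotropy G x\<^esub> g = ginv G g"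
proof -
  interpret H: group "isotropy G x" by (rule isotropy_group[OF x])
  show ?thesis
    using ginv_props[of g] g
    by (intro H.inv_equality) (auto simp: isotropy_def ghom_def)
qed

lemma to_isotropy_closed:
  assumes "transversal G x \<tau>" "g \<in> carrier G"
  shows "to_isotropy G \<tau> g \<in> ghom G x x"
proof -
  have "src g \<in> gobjects G" "tgt g \<in> gobjects G"
    using assms by (auto simp: gobjects_def src_closed tgt_closed src_src src_tgt)
  then have "\<tau> (src g) \<in> ghom G x (src g)" "\<tau> (tgt g) \<in> ghom G x (tgt g)"
    using assms by (auto simp: transversal_def)
  then show ?thesis
    using ginv_props[of "\<tau> (tgt g)"] assms
    by (auto simp: to_isotropy_def ghom_def comp_closed src_comp tgt_comp)
qed

end


section \<open>Ideals and homomorphisms of rings without unit\<close>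

text \<open>The class \<open>ring\<close> does not require a unit. A ring \<open>R\<close> occurring below is a subring, given as a
  set, of a type of this class. Maps are extensional (\<open>undefined\<close> outside their domain), so that
  two maps with a given domain are equal iff they agree on it.\<close>

definition ideal_of :: "'a::ring set \<Rightarrow> 'a set \<Rightarrow> bool"
  where "ideal_of J R \<longleftrightarrow> J \<subseteq> R \<and> 0 \<in> J \<and> (\<forall>a\<in>J. \<forall>b\<in>J. a - b \<in> J)
    \<and> (\<forall>r\<in>R. \<forall>a\<in>J. r * a \<in> J \<and> a * r \<in> J)"

definition rng_hom :: "'a::ring set \<Rightarrow> 'a set \<Rightarrow> ('a \<Rightarrow> 'a) set"
  where "rng_hom R S = {f \<in> R \<rightarrow>\<^sub>E S.
    \<forall>a\<in>R. \<forall>b\<in>R. f (a + b) = f a + f b \<and> f (a * b) = f a * f b}"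

definition rng_iso :: "'a::ring set \<Rightarrow> 'a set \<Rightarrow> ('a \<Rightarrow> 'a) set"
  where "rng_iso R S = {f \<in> rng_hom R S. bij_betw f R S}"


section \<open>Partial group actions on rings\<close>

locale partial_action = group H
  for H :: "('h, 'b) monoid_scheme" (structure)
    and R :: "'a::ring set"
    and D :: "'h \<Rightarrow> 'a set"
    and \<gamma> :: "'h \<Rightarrow> 'a \<Rightarrow> 'a" +
  assumes D_extensional: "D \<in> extensional (carrier H)"
    and \<gamma>_extensional: "\<gamma> \<in> extensional (carrier H)"
    and D_ideal: "h \<in> carrier H \<Longrightarrow> ideal_of (D h) R"
    and \<gamma>_iso: "h \<in> carrier H \<Longrightarrow> \<gamma> h \<in> rng_iso (D (inv h)) (D h)"
    and D_one: "D \<one> = R"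
    and \<gamma>_one: "\<gamma> \<one> = (\<lambda>a\<in>R. a)"
    and \<gamma>_extends: "\<lbrakk>h \<in> carrier H; k \<in> carrier H; a \<in> D (inv k); \<gamma> k a \<in> D (inv h)\<rbrakk>
          \<Longrightarrow> a \<in> D (inv (h \<otimes> k)) \<and> \<gamma> (h \<otimes> k) a = \<gamma> h (\<gamma> k a)"


section \<open>Isomorphism of categories\<close>

text \<open>Hom-sets need not be disjoint; composition and the action of a functor on morphisms are
  therefore indexed by the objects involved. \<open>cmp C X Y Z g f\<close> is the composite of \<open>f : X \<rightarrow> Y\<close>
  and \<open>g : Y \<rightarrow> Z\<close>.\<close>

record ('o, 'm) cat =
  obj :: "'o set"
  mor :: "'o \<Rightarrow> 'o \<Rightarrow> 'm set"
  idn :: "'o \<Rightarrow> 'm"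
  cmp :: "'o \<Rightarrow> 'o \<Rightarrow> 'o \<Rightarrow> 'm \<Rightarrow> 'm \<Rightarrow> 'm"

locale category =
  fixes C :: "('o, 'm) cat"
  assumes idn_mor: "X \<in> obj C \<Longrightarrow> idn C X \<in> mor C X X"
    and cmp_mor: "\<lbrakk>X \<in> obj C; Y \<in> obj C; Z \<in> obj C; f \<in> mor C X Y; g \<in> mor C Y Z\<rbrakk>
          \<Longrightarrow> cmp C X Y Z g f \<in> mor C X Z"
    and cmp_idn: "\<lbrakk>X \<in> obj C; Y \<in> obj C; f \<in> mor C X Y\<rbrakk> \<Longrightarrow> cmp C X X Y f (idn C X) = f"
    and idn_cmp: "\<lbrakk>X \<in> obj C; Y \<in> obj C; f \<in> mor C X Y\<rbrakk> \<Longrightarrow> cmp C X Y Y (idn C Y) f = f"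
    and cmp_assoc: "\<lbrakk>W \<in> obj C; X \<in> obj C; Y \<in> obj C; Z \<in> obj C;
            f \<in> mor C W X; g \<in> mor C X Y; h \<in> mor C Y Z\<rbrakk>
          \<Longrightarrow> cmp C W X Z (cmp C X Y Z h g) f = cmp C W Y Z h (cmp C W X Y g f)"

locale cat_functor = C: category C + D: category D
  for C :: "('o, 'm) cat" and D :: "('p, 'n) cat"
    and F :: "'o \<Rightarrow> 'p" and Fm :: "'o \<Rightarrow> 'o \<Rightarrow> 'm \<Rightarrow> 'n" +
  assumes F_obj: "X \<in> obj C \<Longrightarrow> F X \<in> obj D"
    and F_mor: "\<lbrakk>X \<in> obj C; Y \<in> obj C; f \<in> mor C X Y\<rbrakk> \<Longrightarrow> Fm X Y f \<in> mor D (F X) (F Y)"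
    and F_idn: "X \<in> obj C \<Longrightarrow> Fm X X (idn C X) = idn D (F X)"
    and F_cmp: "\<lbrakk>X \<in> obj C; Y \<in> obj C; Z \<in> obj C; f \<in> mor C X Y; g \<in> mor C Y Z\<rbrakk>
          \<Longrightarrow> Fm X Z (cmp C X Y Z g f) = cmp D (F X) (F Y) (F Z) (Fm Y Z g) (Fm X Y f)"

definition left_inverse_functor ::
    "('o, 'm) cat \<Rightarrow> ('o \<Rightarrow> 'p) \<Rightarrow> ('o \<Rightarrow> 'o \<Rightarrow> 'm \<Rightarrow> 'n) \<Rightarrow>
     ('p \<Rightarrow> 'o) \<Rightarrow> ('p \<Rightarrow> 'p \<Rightarrow> 'n \<Rightarrow> 'm) \<Rightarrow> bool"
  where "left_inverse_functor C F Fm K Km \<longleftrightarrow>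
    (\<forall>X\<in>obj C. K (F X) = X) \<and>
    (\<forall>X\<in>obj C. \<forall>Y\<in>obj C. \<forall>f\<in>mor C X Y. Km (F X) (F Y) (Fm X Y f) = f)"

definition isomorphic_categories :: "('o, 'm) cat \<Rightarrow> ('p, 'n) cat \<Rightarrow> bool"
  where "isomorphic_categories C D \<longleftrightarrow>
    (\<exists>F Fm K Km. cat_functor C D F Fm \<and> cat_functor D C K Km \<and>
       left_inverse_functor C F Fm K Km \<and> left_inverse_functor D K Km F Fm)"


section \<open>The category of data attached to a transversal\<close>

text \<open>In the notation of the mathematics, for an object \<open>y\<close> of the groupoid and \<open>h\<close> in the isotropy
  group at \<open>x\<close>: \<open>obj_ideal y\<close> is \<open>I\<^sub>y\<close>; \<open>tr_dom y\<close> and \<open>tr_cod y\<close> are the ideals indexed by the inverse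
  of \<open>\<tau>\<^sub>y\<close> and by \<open>\<tau>\<^sub>y\<close>; \<open>tr_map y\<close> is the isomorphism indexed by \<open>\<tau>\<^sub>y\<close>; \<open>iso_ideal h\<close> and \<open>iso_map h\<close>
  are \<open>I\<^sub>h\<close> and \<open>\<gamma>\<^sub>h\<close>.\<close>

record ('g, 'a) D_data =
  obj_ideal :: "'g \<Rightarrow> 'a set"
  tr_dom :: "'g \<Rightarrow> 'a set"
  tr_cod :: "'g \<Rightarrow> 'a set"
  tr_map :: "'g \<Rightarrow> 'a \<Rightarrow> 'a"
  iso_ideal :: "'g \<Rightarrow> 'a set"
  iso_map :: "'g \<Rightarrow> 'a \<Rightarrow> 'a"

text \<open>The ambient ring \<open>A\<close> is the whole type \<open>'a\<close>. All families are extensional, so that equality of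
  objects is equality of the families over their index sets.\<close>

locale D_object =
  fixes G (structure)
    and x :: 'g
    and \<tau> :: "'g \<Rightarrow> 'g"
    and X :: "('g, 'a::ring) D_data"
  assumes extensional:
      "obj_ideal X \<in> extensional (gobjects G)"
      "tr_dom X \<in> extensional (gobjects G)"
      "tr_cod X \<in> extensional (gobjects G)"
      "tr_map X \<in> extensional (gobjects G)"
    and obj_ideal: "y \<in> gobjects G \<Longrightarrow> ideal_of (obj_ideal X y) UNIV"
    and tr_map: "y \<in> gobjects G \<Longrightarrow> tr_map X y \<in> rng_iso (tr_dom X y) (tr_cod X y)"
    and action: "partial_action (isotropy G x) (obj_ideal X x) (iso_ideal X) (iso_map X)"
    and base: "tr_dom X x = obj_ideal X x" "tr_cod X x = obj_ideal X x"
      "tr_map X x = (\<lambda>a\<in>obj_ideal X x. a)"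
    and tr_cod_ideal: "y \<in> gobjects G \<Longrightarrow> ideal_of (tr_cod X y) (obj_ideal X y)"
    and tr_dom_ideal: "y \<in> gobjects G \<Longrightarrow> ideal_of (tr_dom X y) (obj_ideal X x)"
    and composite_ideal: "g \<in> carrier G \<Longrightarrow>
      ideal_of
        (tr_map X (tgt g) `
          (tr_dom X (tgt g) \<inter>
            iso_map X (to_isotropy G \<tau> g) `
              (tr_dom X (src g) \<inter> iso_ideal X (ginv G (to_isotropy G \<tau> g)))))
        (obj_ideal X (tgt g))"

definition D_hom ::
    "('g, 'b) groupoid_scheme \<Rightarrow> 'g \<Rightarrow> ('g, 'a::ring) D_data \<Rightarrow> ('g, 'a) D_data \<Rightarrow> ('g \<Rightarrow> 'a \<Rightarrow> 'a) set"
  where "D_hom G x X Y = {f \<in> extensional (gobjects G).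
    (\<forall>y\<in>gobjects G.
       f y \<in> rng_hom (obj_ideal X y) (obj_ideal Y y) \<and>
       (y \<noteq> x \<longrightarrow> f y ` tr_cod X y \<subseteq> tr_cod Y y) \<and>
       f x ` tr_dom X y \<subseteq> tr_dom Y y \<and>
       (\<forall>a\<in>tr_dom X y. tr_map Y y (f x a) = f y (tr_map X y a))) \<and>
    (\<forall>h\<in>ghom G x x.
       f x ` iso_ideal X h \<subseteq> iso_ideal Y h \<and>
       (\<forall>a\<in>iso_ideal X (ginv G h). iso_map Y h (f x a) = f x (iso_map X h a)))}"

definition D_cat ::
    "('g, 'b) groupoid_scheme \<Rightarrow> 'g \<Rightarrow> ('g \<Rightarrow> 'g) \<Rightarrow> (('g, 'a::ring) D_data, 'g \<Rightarrow> 'a \<Rightarrow> 'a) cat"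
  where "D_cat G x \<tau> = \<lparr>
    obj = {X. D_object G x \<tau> X},
    mor = D_hom G x,
    idn = (\<lambda>X. \<lambda>y\<in>gobjects G. \<lambda>a\<in>obj_ideal X y. a),
    cmp = (\<lambda>X Y Z g f. \<lambda>y\<in>gobjects G. compose (obj_ideal X y) (g y) (f y))\<rparr>"

lemma category_D_cat:
  assumes G: "groupoid G" and x: "x \<in> gobjects G"
  shows "category (D_cat G x \<tau> :: (('g, 'a::ring) D_data, 'g \<Rightarrow> 'a \<Rightarrow> 'a) cat)"
proof -
  interpret groupoid G by (rule G)
  have sub: "tr_dom X y \<subseteq> obj_ideal X x" "tr_cod X y \<subseteq> obj_ideal X y"
    "\<And>a. a \<in> tr_dom X y \<Longrightarrow> tr_map X y a \<in> tr_cod X y"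
    if "D_object G x \<tau> X" "y \<in> gobjects G" for X :: "('g, 'a) D_data" and y
    using that by (auto simp: D_object_def ideal_of_def rng_iso_def rng_hom_def)
  have isub: "iso_ideal X h \<subseteq> obj_ideal X x" "iso_ideal X (ginv G h) \<subseteq> obj_ideal X x"
    "\<And>a. a \<in> iso_ideal X (ginv G h) \<Longrightarrow> iso_map X h a \<in> iso_ideal X h"
    if X: "D_object G x \<tau> X" and h: "h \<in> ghom G x x" for X :: "('g, 'a) D_data" and h
  proof -
    interpret P: partial_action "isotropy G x" "obj_ideal X x" "iso_ideal X" "iso_map X"
      using X by (simp add: D_object_def)
    have h': "h \<in> carrier (isotropy G x)" "ginv G h \<in> carrier (isotropy G x)"
      using h ginv_props(1)[of h] by (auto simp: isotropy_def ghom_def)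
    show "iso_ideal X h \<subseteq> obj_ideal X x" "iso_ideal X (ginv G h) \<subseteq> obj_ideal X x"
      using P.D_ideal h' by (auto simp: ideal_of_def)
    show "\<And>a. a \<in> iso_ideal X (ginv G h) \<Longrightarrow> iso_map X h a \<in> iso_ideal X h"
      using P.\<gamma>_iso[OF h'(1)] isotropy_inv[OF x h] by (auto simp: rng_iso_def rng_hom_def)
  qed
  have val: "f y a \<in> obj_ideal Y y"
    if "f \<in> D_hom G x X Y" "y \<in> gobjects G" "a \<in> obj_ideal X y"
    for X Y :: "('g, 'a) D_data" and f y a
    using that by (auto simp: D_hom_def rng_hom_def)
  have add_mult: "f y (a + b) = f y a + f y b" "f y (a * b) = f y a * f y b"
    if "f \<in> D_hom G x X Y" "y \<in> gobjects G" "a \<in> obj_ideal X y" "b \<in> obj_ideal X y"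
    for X Y :: "('g, 'a) D_data" and f y a b
    using that by (auto simp: D_hom_def rng_hom_def)
  have ring: "a + b \<in> obj_ideal X y" "a * b \<in> obj_ideal X y"
    if "D_object G x \<tau> X" "y \<in> gobjects G" "a \<in> obj_ideal X y" "b \<in> obj_ideal X y"
    for X :: "('g, 'a) D_data" and y a b
  proof -
    have I: "ideal_of (obj_ideal X y) UNIV"
      using that by (auto simp: D_object_def)
    then have "a - (0 - b) \<in> obj_ideal X y"
      using that unfolding ideal_of_def by blast
    then show "a + b \<in> obj_ideal X y" by simp
    show "a * b \<in> obj_ideal X y"
      using I that by (auto simp: ideal_of_def)
  qed
  have ext: "f y \<in> extensional (obj_ideal X y)" "f \<in> extensional (gobjects G)"
    if "f \<in> D_hom G x X Y" "y \<in> gobjects G" for X Y :: "('g, 'a) D_data" and f y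
    using that by (auto simp: D_hom_def rng_hom_def PiE_def)
  show ?thesis
  proof (unfold_locales, goal_cases)
    case (1 X)
    then have X: "D_object G x \<tau> X" by (simp add: D_cat_def)
    show ?case
      using x sub[OF X] isub[OF X] ring[OF X]
      by (auto simp: D_cat_def D_hom_def rng_hom_def subset_iff)
  next
    case (2 X Y Z f g)
    then have X: "D_object G x \<tau> X" and Y: "D_object G x \<tau> Y" and Z: "D_object G x \<tau> Z"
      and f: "f \<in> D_hom G x X Y" and g: "g \<in> D_hom G x Y Z"
      by (auto simp: D_cat_def)
    let ?c = "\<lambda>y\<in>gobjects G. compose (obj_ideal X y) (g y) (f y)"
    have 1: "?c y \<in> rng_hom (obj_ideal X y) (obj_ideal Z y)" if "y \<in> gobjects G" for y
      using that val[OF f] val[OF g] add_mult[OF f] add_mult[OF g] ring[OF X] by (auto simp: rng_hom_def compose_def)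
    have 2: "?c y ` tr_cod X y \<subseteq> tr_cod Z y" if "y \<in> gobjects G" "y \<noteq> x" for y
      using that f g sub[OF X that(1)] by (fastforce simp: D_hom_def compose_def)
    have 3: "?c x ` tr_dom X y \<subseteq> tr_dom Z y" if "y \<in> gobjects G" for y
      using that x f g sub[OF X that(1)] by (fastforce simp: D_hom_def compose_def)
    have 4: "tr_map Z y (?c x a) = ?c y (tr_map X y a)"
      if y: "y \<in> gobjects G" and a: "a \<in> tr_dom X y" for y a
    proof -
      have "f x ` tr_dom X y \<subseteq> tr_dom Y y"
        using f y by (simp add: D_hom_def)
      then have "a \<in> obj_ideal X x" "tr_map X y a \<in> obj_ideal X y" "f x a \<in> tr_dom Y y"
        using sub[OF X y] a by auto
      moreover have "tr_map Y y (f x a) = f y (tr_map X y a)"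
        "tr_map Z y (g x (f x a)) = g y (tr_map Y y (f x a))"
        using f g y a calculation by (auto simp: D_hom_def)
      ultimately show ?thesis
        using x y by (simp add: compose_def)
    qed
    have 5: "?c x ` iso_ideal X h \<subseteq> iso_ideal Z h" if "h \<in> ghom G x x" for h
      using that x f g isub[OF X that] by (fastforce simp: D_hom_def compose_def)
    have 6: "iso_map Z h (?c x a) = ?c x (iso_map X h a)"
      if h: "h \<in> ghom G x x" and a: "a \<in> iso_ideal X (ginv G h)" for h a
    proof -
      have "ginv G h \<in> ghom G x x"
        using h ginv_props(1)[of h] by (auto simp: ghom_def)
      then have "f x ` iso_ideal X (ginv G h) \<subseteq> iso_ideal Y (ginv G h)"
        using f by (simp add: D_hom_def)
      then have "a \<in> obj_ideal X x" "iso_map X h a \<in> obj_ideal X x"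
        "f x a \<in> iso_ideal Y (ginv G h)"
        using isub[OF X h] a by auto
      moreover have "iso_map Y h (f x a) = f x (iso_map X h a)"
        "iso_map Z h (g x (f x a)) = g x (iso_map Y h (f x a))"
        using f g h a calculation by (auto simp: D_hom_def)
      ultimately show ?thesis
        using x by (simp add: compose_def)
    qed
    show ?case
      using 1 2 3 4 5 6 unfolding D_cat_def D_hom_def by simp
  next
    case (3 X Y f)
    then have f: "f \<in> D_hom G x X Y" by (simp add: D_cat_def)
    show ?case
      using ext(1)[OF f] ext(2)[OF f x] by (auto simp: D_cat_def compose_def fun_eq_iff restrict_def extensional_def)
  next
    case (4 X Y f)
    then have f: "f \<in> D_hom G x X Y" by (simp add: D_cat_def)
    show ?case
      using ext(1)[OF f] ext(2)[OF f x] val[OF f]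
      by (auto simp: D_cat_def compose_def fun_eq_iff restrict_def extensional_def)
  next
    case (5 W X Y Z f g h)
    then have f: "f \<in> D_hom G x W X" by (simp add: D_cat_def)
    show ?case
      using val[OF f] by (auto simp: D_cat_def compose_def fun_eq_iff restrict_def)
  qed
qed

end

theory Submission imports Defs "HOL-Combinatorics.Transposition" begin

text \<open>The map \<open>g \<mapsto> g\<^sub>x\<close> is a bijection from each hom-set onto \<open>\<G>(x)\<close>, so in condition (f) the triple
  of source, target and \<open>g\<^sub>x\<close> ranges over all triples of two objects and an element of \<open>\<G>(x)\<close>.
  Hence \<open>\<D>\<close> depends only on the set of objects pointed at \<open>x\<close> and on the group \<open>\<G>(x)\<close>, and
  relabelling along the transposition of \<open>x\<close> and \<open>z\<close> and an isomorphism \<open>\<G>(z) \<cong> \<G>(x)\<close> is an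
  isomorphism of categories. The evident alternative, restricting the groupoid action to \<open>z\<close>,
  would lose the action of \<open>\<G>(x)\<close> outside the domain of \<open>\<gamma>\<close> at \<open>\<tau>\<^sub>z\<close>.\<close>

context groupoid
begin

lemma ginv_closed: "g \<in> carrier G \<Longrightarrow> ginv G g \<in> carrier G"
  and src_ginv: "g \<in> carrier G \<Longrightarrow> src (ginv G g) = tgt g"
  and tgt_ginv: "g \<in> carrier G \<Longrightarrow> tgt (ginv G g) = src g"
  using ginv_props(1)[of g] by (auto simp: ghom_def)

text \<open>The trailing factor \<open>h\<close> gives the shape in which inverse pairs occur once
  \<open>comp_assoc\<close> has nested products to the right.\<close>

lemma comp_ginv_cancel:
  assumes "g \<in> carrier G" "h \<in> carrier G" "tgt g = tgt h"
  shows "g \<cdot> (ginv G g \<cdot> h) = h"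
  using comp_assoc[of g "ginv G g" h] assms ginv_props(3)[of g] tgt_comp_left[of h]
  by (simp add: ginv_closed src_ginv tgt_ginv)

lemma ginv_comp_cancel:
  assumes "g \<in> carrier G" "h \<in> carrier G" "src g = tgt h"
  shows "ginv G g \<cdot> (g \<cdot> h) = h"
  using comp_assoc[of "ginv G g" g h] assms ginv_props(2)[of g] tgt_comp_left[of h]
  by (simp add: ginv_closed src_ginv tgt_ginv)

text \<open>Multiplying by \<open>\<tau> w\<close> on the left and by the inverse of
  \<open>\<tau> y\<close> on the right undoes the map.\<close>

lemma to_isotropy_bij_betw:
  assumes \<tau>: "transversal G x \<tau>" and y: "y \<in> gobjects G" and w: "w \<in> gobjects G"
  shows "bij_betw (to_isotropy G \<tau>) (ghom G y w) (ghom G x x)"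
proof (rule bij_betw_byWitness[where f' = "\<lambda>h. \<tau> w \<cdot> h \<cdot> ginv G (\<tau> y)"])
  have c: "\<tau> y \<in> carrier G" "src (\<tau> y) = x" "tgt (\<tau> y) = y"
    and d: "\<tau> w \<in> carrier G" "src (\<tau> w) = x" "tgt (\<tau> w) = w"
    using assms by (auto simp: transversal_def ghom_def)
  note typing = c d ginv_closed src_ginv tgt_ginv comp_closed src_comp tgt_comp
  \<comment> \<open>An inverse pair at the right end of a product has no factor behind it, so the
    cancellation lemmas miss it.\<close>
  have right: "g \<cdot> (\<tau> y \<cdot> ginv G (\<tau> y)) = g" if "g \<in> ghom G y w" for g
    using that comp_src[of g] ginv_props(3)[OF c(1)] c by (auto simp: ghom_def)
  have left: "h \<cdot> (ginv G (\<tau> y) \<cdot> \<tau> y) = h" if "h \<in> ghom G x x" for h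
    using that comp_src[of h] ginv_props(2)[OF c(1)] c by (auto simp: ghom_def)
  show "\<forall>g\<in>ghom G y w. \<tau> w \<cdot> to_isotropy G \<tau> g \<cdot> ginv G (\<tau> y) = g"
    using right by (auto simp: ghom_def to_isotropy_def comp_assoc typing comp_ginv_cancel)
  show "\<forall>h\<in>ghom G x x. to_isotropy G \<tau> (\<tau> w \<cdot> h \<cdot> ginv G (\<tau> y)) = h"
    using left by (auto simp: ghom_def to_isotropy_def comp_assoc typing ginv_comp_cancel)
  show "to_isotropy G \<tau> ` ghom G y w \<subseteq> ghom G x x"
    using to_isotropy_closed[OF \<tau>] by (auto simp: ghom_def)
  show "(\<lambda>h. \<tau> w \<cdot> h \<cdot> ginv G (\<tau> y)) ` ghom G x x \<subseteq> ghom G y w"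
    by (auto simp: ghom_def typing)
qed

text \<open>In the product on the right the inner factors are \<open>\<tau> (src g)\<close> and the
  inverse of \<open>\<tau> (tgt h)\<close>, which cancel because
  \<open>src g = tgt h\<close>.\<close>

lemma to_isotropy_comp:
  assumes \<tau>: "transversal G x \<tau>"
    and g: "g \<in> carrier G" and h: "h \<in> carrier G" and gh: "src g = tgt h"
  shows "to_isotropy G \<tau> (g \<cdot> h) = to_isotropy G \<tau> g \<cdot> to_isotropy G \<tau> h"
proof -
  have \<tau>_props: "\<tau> y \<in> carrier G" "src (\<tau> y) = x" "tgt (\<tau> y) = y" if "y \<in> gobjects G" for y
    using that \<tau> by (auto simp: transversal_def ghom_def)
  have "src h \<in> gobjects G" "tgt h \<in> gobjects G" "tgt g \<in> gobjects G"
    using g h by (auto simp: gobjects_def src_closed tgt_closed src_src src_tgt)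
  note typing = this[THEN \<tau>_props(1)] this[THEN \<tau>_props(2)] this[THEN \<tau>_props(3)]
    ginv_closed src_ginv tgt_ginv comp_closed src_comp tgt_comp
  show ?thesis
    using g h gh by (simp add: to_isotropy_def comp_assoc typing comp_ginv_cancel)
qed

lemma to_isotropy_iso:
  assumes "transversal G x \<tau>" "z \<in> gobjects G"
  shows "to_isotropy G \<tau> \<in> iso (isotropy G z) (isotropy G x)"
  using to_isotropy_bij_betw[OF assms(1,2,2)] to_isotropy_comp[OF assms(1)]
  by (auto simp: iso_def hom_def isotropy_def ghom_def bij_betw_def)

text \<open>Every \<open>h\<close> in the isotropy group comes from some arrow from \<open>y\<close>
  to \<open>w\<close>, so the three arguments of \<open>P\<close> vary independently. Applied to
  condition (f), this removes the transversal.\<close>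

lemma ball_to_isotropy_iff:
  assumes "transversal G x \<tau>"
  shows "(\<forall>g\<in>carrier G. P (src g) (tgt g) (to_isotropy G \<tau> g)) \<longleftrightarrow>
    (\<forall>y\<in>gobjects G. \<forall>w\<in>gobjects G. \<forall>h\<in>ghom G x x. P y w h)" (is "?L \<longleftrightarrow> ?R")
proof
  assume L: ?L
  show ?R
  proof (intro ballI)
    fix y w h assume "y \<in> gobjects G" "w \<in> gobjects G" "h \<in> ghom G x x"
    then obtain g where "g \<in> ghom G y w" "h = to_isotropy G \<tau> g"
      using to_isotropy_bij_betw[OF assms] by (fastforce simp: bij_betw_def)
    then show "P y w h"
      using L by (auto simp: ghom_def)
  qed
next
  assume ?R
  then show ?L
    using to_isotropy_closed[OF assms]
    by (simp add: gobjects_def src_closed tgt_closed src_src src_tgt)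
qed

end

text \<open>A homomorphism preserves unit, inverses and products, so each axiom at \<open>k\<close>
  is the old axiom at \<open>\<psi> k\<close>. Restricting to the carrier keeps the families
  extensional.\<close>

lemma partial_action_reindex:
  assumes "partial_action H R D \<gamma>" and K: "group K" and \<psi>: "\<psi> \<in> hom K H"
  shows "partial_action K R (\<lambda>k\<in>carrier K. D (\<psi> k)) (\<lambda>k\<in>carrier K. \<gamma> (\<psi> k))"
proof -
  interpret H: partial_action H R D \<gamma> by fact
  interpret \<psi>: group_hom K H \<psi>
    using K \<psi> by (simp add: group_hom_def group_hom_axioms_def H.group_axioms)
  show ?thesis
    by unfold_locales
      (use H.D_ideal H.\<gamma>_iso H.\<gamma>_extends H.D_one H.\<gamma>_one in auto)
qed

text \<open>Both index changes are pullbacks: the transposition sends the new base point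
  \<open>z\<close> to \<open>x\<close>, and \<psi> is meant to go from the isotropy group at
  \<open>z\<close> to the one at \<open>x\<close>. The ideals and maps themselves stay the
  same.\<close>

definition relabel :: "('g, 'b) groupoid_scheme \<Rightarrow> 'g \<Rightarrow> 'g \<Rightarrow> ('g \<Rightarrow> 'g)
    \<Rightarrow> ('g, 'a) D_data \<Rightarrow> ('g, 'a) D_data"
  where "relabel G x z \<psi> X = \<lparr>
    obj_ideal = (\<lambda>y\<in>gobjects G. obj_ideal X (transpose x z y)),
    tr_dom = (\<lambda>y\<in>gobjects G. tr_dom X (transpose x z y)),
    tr_cod = (\<lambda>y\<in>gobjects G. tr_cod X (transpose x z y)),
    tr_map = (\<lambda>y\<in>gobjects G. tr_map X (transpose x z y)),
    iso_ideal = (\<lambda>h\<in>ghom G z z. iso_ideal X (\<psi> h)),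
    iso_map = (\<lambda>h\<in>ghom G z z. iso_map X (\<psi> h))\<rparr>"

text \<open>A morphism has components at objects only, so \<psi> does not enter.\<close>

definition relabel_hom :: "('g, 'b) groupoid_scheme \<Rightarrow> 'g \<Rightarrow> 'g \<Rightarrow> ('g \<Rightarrow> 'm) \<Rightarrow> 'g \<Rightarrow> 'm"
  where "relabel_hom G x z f = (\<lambda>y\<in>gobjects G. f (transpose x z y))"

lemma transpose_closed: "x \<in> S \<Longrightarrow> z \<in> S \<Longrightarrow> y \<in> S \<Longrightarrow> transpose x z y \<in> S"
  by (auto simp: transpose_def)

text \<open>Swapping \<open>x\<close> with \<open>z\<close> and inverting \<psi> gives another
  instance, so each result also serves the functor in the opposite direction.\<close>

locale relabelling = groupoid G for G :: "('g, 'b) groupoid_scheme" (structure) +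
  fixes x z :: 'g and \<psi> :: "'g \<Rightarrow> 'g"
  assumes x: "x \<in> gobjects G" and z: "z \<in> gobjects G"
    and \<psi>: "\<psi> \<in> iso (isotropy G z) (isotropy G x)"
begin

lemma \<psi>_closed: "h \<in> ghom G z z \<Longrightarrow> \<psi> h \<in> ghom G x x"
  using \<psi> by (auto simp: iso_def hom_def isotropy_def)

lemma \<psi>_ginv:
  assumes "h \<in> ghom G z z"
  shows "\<psi> (ginv G h) = ginv G (\<psi> h)"
proof -
  interpret \<psi>: group_hom "isotropy G z" "isotropy G x" \<psi>
    using \<psi> isotropy_group[OF x] isotropy_group[OF z]
    by (simp add: group_hom_def group_hom_axioms_def iso_def)
  show ?thesis
    using \<psi>.hom_inv[of h] assms isotropy_inv[OF z assms] isotropy_inv[OF x \<psi>_closed[OF assms]]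
    by (simp add: isotropy_def)
qed

lemma ginv_ghom: "h \<in> ghom G z z \<Longrightarrow> ginv G h \<in> ghom G z z"
  using ginv_props(1)[of h] by (auto simp: ghom_def)

lemmas simps = x z \<psi>_closed \<psi>_ginv ginv_ghom transpose_closed[OF x z]

text \<open>Only (f) mentions the transversal. It is turned into its form over triples using \<tau>,
  relabelled there, and turned back using \<mu>.\<close>

lemma D_object_relabel:
  assumes \<tau>: "transversal G x \<tau>" and \<mu>: "transversal G z \<mu>" and X: "D_object G x \<tau> X"
  shows "D_object G z \<mu> (relabel G x z \<psi> X)"
proof -
  interpret X: D_object G x \<tau> X by (rule X)
  let ?X = "relabel G x z \<psi> X"
  let ?I = "\<lambda>X y w h. ideal_of (tr_map X w ` (tr_dom X w \<inter>
    iso_map X h ` (tr_dom X y \<inter> iso_ideal X (ginv G h)))) (obj_ideal X w)"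
  have "?I X y w h" if "y \<in> gobjects G" "w \<in> gobjects G" "h \<in> ghom G x x" for y w h
    using that X.composite_ideal ball_to_isotropy_iff[OF \<tau>, of "?I X"] by auto
  \<comment> \<open>The claim at \<open>(y, w, h)\<close> is the one for \<open>X\<close> at the
    transposed objects and \<open>\<psi> h\<close>, because \<psi> commutes with
    \<open>ginv\<close>.\<close>
  then have "\<forall>y\<in>gobjects G. \<forall>w\<in>gobjects G. \<forall>h\<in>ghom G z z. ?I ?X y w h"
    by (simp add: relabel_def simps)
  then have composite: "\<forall>g\<in>carrier G. ?I ?X (src g) (tgt g) (to_isotropy G \<mu> g)"
    using ball_to_isotropy_iff[OF \<mu>, of "?I ?X"] by blast
  have action: "partial_action (isotropy G z) (obj_ideal X x)
      (\<lambda>h\<in>ghom G z z. iso_ideal X (\<psi> h)) (\<lambda>h\<in>ghom G z z. iso_map X (\<psi> h))"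
    using partial_action_reindex[OF X.action isotropy_group[OF z], of \<psi>] \<psi>
    by (simp add: iso_def isotropy_def)
  show ?thesis
    by (rule D_object.intro)
      (use composite action in \<open>simp_all add: relabel_def simps X.obj_ideal X.tr_map X.base
         X.tr_cod_ideal X.tr_dom_ideal\<close>)
qed

lemma D_hom_relabel:
  assumes f: "f \<in> D_hom G x X Y"
  shows "relabel_hom G x z f \<in> D_hom G z (relabel G x z \<psi> X) (relabel G x z \<psi> Y)"
proof -
  \<comment> \<open>The condition on \<open>tr_cod\<close> exempts the base point, so indices other
    than \<open>z\<close> must go to indices other than \<open>x\<close>.\<close>
  have "transpose x z y \<noteq> x" if "y \<noteq> z" for y
    using that by (auto simp: transpose_def split: if_splits)
  then show ?thesis
    using f by (simp add: D_hom_def relabel_def relabel_hom_def simps)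
qed

lemma relabelling_inverse: "relabelling G z x (inv_into (ghom G z z) \<psi>)"
proof unfold_locales
  interpret Z: group "isotropy G z" by (rule isotropy_group[OF z])
  show "inv_into (ghom G z z) \<psi> \<in> iso (isotropy G x) (isotropy G z)"
    using Z.iso_set_sym[OF \<psi>] by (simp add: isotropy_def)
qed (rule x z)+

text \<open>The transposition is an involution and \<psi> maps onto the isotropy group at
  \<open>x\<close>. Off the index sets both records agree by extensionality.\<close>

lemma relabel_inverse:
  assumes "D_object G x \<tau> X"
  shows "relabel G z x (inv_into (ghom G z z) \<psi>) (relabel G x z \<psi> X) = X"
proof -
  interpret X: D_object G x \<tau> X by fact
  interpret P: partial_action "isotropy G x" "obj_ideal X x" "iso_ideal X" "iso_map X"
    by (rule X.action)
  interpret inv: relabelling G z x "inv_into (ghom G z z) \<psi>" by (rule relabelling_inverse)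
  have "\<psi> ` ghom G z z = ghom G x x"
    using \<psi> by (auto simp: iso_def bij_betw_def isotropy_def)
  then have "\<psi> (inv_into (ghom G z z) \<psi> h) = h" if "h \<in> ghom G x x" for h
    using that by (simp add: f_inv_into_f)
  then show ?thesis
    using P.D_extensional P.\<gamma>_extensional X.extensional
    by (intro D_data.equality)
      (simp_all add: relabel_def simps inv.simps transpose_commute[of z x] isotropy_def
        fun_eq_iff extensional_def)
qed

lemma relabel_hom_inverse:
  assumes "f \<in> D_hom G x X Y"
  shows "relabel_hom G z x (relabel_hom G x z f) = f"
  using assms
  by (simp add: D_hom_def relabel_hom_def simps transpose_commute[of z x] fun_eq_iff
      extensional_def)

text \<open>Identities and composites are formed component by component, so reindexing the
  components preserves them.\<close>

lemma cat_functor_relabel: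
  assumes \<tau>: "transversal G x \<tau>" and \<mu>: "transversal G z \<mu>"
  shows "cat_functor
    (D_cat G x \<tau> :: (('g, 'a::ring) D_data, 'g \<Rightarrow> 'a \<Rightarrow> 'a) cat) (D_cat G z \<mu>)
    (relabel G x z \<psi>) (\<lambda>X Y. relabel_hom G x z)"
proof -
  interpret C: category "D_cat G x \<tau> :: (('g, 'a) D_data, 'g \<Rightarrow> 'a \<Rightarrow> 'a) cat"
    by (rule category_D_cat[OF groupoid_axioms x])
  interpret D: category "D_cat G z \<mu> :: (('g, 'a) D_data, 'g \<Rightarrow> 'a \<Rightarrow> 'a) cat"
    by (rule category_D_cat[OF groupoid_axioms z])
  show ?thesis
    by unfold_locales
      (simp_all add: D_cat_def D_object_relabel[OF \<tau> \<mu>] D_hom_relabel,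
        auto simp: relabel_def relabel_hom_def simps fun_eq_iff)
qed

lemma left_inverse_functor_relabel:
  "left_inverse_functor (D_cat G x \<tau>) (relabel G x z \<psi>) (\<lambda>X Y. relabel_hom G x z)
    (relabel G z x (inv_into (ghom G z z) \<psi>)) (\<lambda>X Y. relabel_hom G z x)"
  by (auto simp: left_inverse_functor_def D_cat_def relabel_inverse relabel_hom_inverse)

end

theorem proposition3p2:
  fixes G :: "'g groupoid"
    and x z :: 'g
    and \<tau> \<mu> :: "'g \<Rightarrow> 'g"
  assumes "connected_groupoid G"
    and "x \<in> gobjects G" and "z \<in> gobjects G"
    and "transversal G x \<tau>" and "transversal G z \<mu>"
  shows "isomorphic_categories
           (D_cat G x \<tau> :: (('g, 'a::ring) D_data, 'g \<Rightarrow> 'a \<Rightarrow> 'a) cat)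
           (D_cat G z \<mu> :: (('g, 'a) D_data, 'g \<Rightarrow> 'a \<Rightarrow> 'a) cat)"
proof -
  interpret groupoid G using assms(1) by (simp add: connected_groupoid_def)
  \<comment> \<open>On the isotropy group at \<open>z\<close> this is conjugation by
    \<open>\<tau> z\<close>.\<close>
  let ?\<psi> = "to_isotropy G \<tau>"
  let ?\<phi> = "inv_into (ghom G z z) ?\<psi>"
  interpret F: relabelling G x z ?\<psi>
    by unfold_locales (use assms to_isotropy_iso in auto)
  interpret K: relabelling G z x ?\<phi> by (rule F.relabelling_inverse)
  have inj: "inj_on ?\<psi> (ghom G z z)" and surj: "?\<psi> ` ghom G z z = ghom G x x"
    using to_isotropy_bij_betw[OF assms(4,3,3)] by (auto simp: bij_betw_def)
  have "relabel G x z ?\<psi> (relabel G z x ?\<phi> X) = X" if "D_object G z \<mu> X" for X :: "('g, 'a) D_data"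
  proof -
    \<comment> \<open>The instance \<open>K\<close> yields the inverse of the inverse of
      \<open>?\<psi>\<close>. It equals \<open>?\<psi>\<close> on \<open>ghom G z z\<close>, and
      \<open>relabel\<close> evaluates its map only there.\<close>
    have eq: "relabel G x z (inv_into (ghom G x x) ?\<phi>) Y = relabel G x z ?\<psi> Y"
      for Y :: "('g, 'a) D_data"
      unfolding relabel_def
      using inv_into_inv_into_eq[of ?\<psi> "ghom G z z" "ghom G x x"] inj surj
      by (auto simp: bij_betw_def intro!: restrict_ext)
    show ?thesis
      using K.relabel_inverse[OF that] unfolding eq .
  qed
  then have "left_inverse_functor (D_cat G z \<mu> :: (('g, 'a) D_data, 'g \<Rightarrow> 'a \<Rightarrow> 'a) cat)
      (relabel G z x ?\<phi>) (\<lambda>X Y. relabel_hom G z x) (relabel G x z ?\<psi>) (\<lambda>X Y. relabel_hom G x z)"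
    by (auto simp: left_inverse_functor_def D_cat_def K.relabel_hom_inverse)
  then show ?thesis
    unfolding isomorphic_categories_def
    using F.cat_functor_relabel[OF assms(4,5)] K.cat_functor_relabel[OF assms(5,4)]
      F.left_inverse_functor_relabel by blast
qed

end
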